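(* Let $\mathbb{F}_q$ be a finite field of even characteristic, let $a,b\in\mathbb{F}_q$ with $b\ne 0$, and let $n\ge 2$, $t\ge 2$ be integers. Let $f_1,\dots,f_{t-1}\in\mathbb{F}_q[x]$ and let $C$ be the linear code over $\mathbb{F}_q$ with generator matrix $(I_n\ f_1(T_n(a,b,b))\ \cdots\ f_{t-1}(T_n(a,b,b)))$. Let $r$ be the largest integer such that $n+1=2^r(m+1)$ for an integer $m$ (so $m$ is even). Then: (1) If $r=0$, then $C$ is Euclidean LCD if and only if $$1\notin\left\{f_1(a-b(\theta^i+\theta^{-i}))+\cdots+f_{t-1}(a-b(\theta^i+\theta^{-i})):\ 1\le i\le \tfrac n2\right\},$$ where $\theta$ is a primitive $(n+1)$-th root of $1$. (2) If $r\ge 1$ and $m\ge 1$, then $C$ is Euclidean LCD if and only if $$1\notin\{f_1(a)+\cdots+f_{t-1}(a)\}\cup\left\{f_1(a+b(\theta^i+\theta^{-i}))+\cdots+f_{t-1}(a+b(\theta^i+\theta^{-i})):\ 1\le i\le\tfrac m2\right\},$$ where $\theta$ is a primitive $(m+1)$-th root of $1$. (3) If $r\ge 1$ and $m=0$, then $C$ is Euclidean LCD if and only if $1\notin\{f_1(a)+\cdots+f_{t-1}(a)\}$.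
   Context: $T_n(a,b,c)$ denotes the $n\times n$ tridiagonal Toeplitz matrix with all diagonal entries equal to $a$, all subdiagonal entries equal to $b$, all superdiagonal entries equal to $c$, and all other entries $0$. $I_n$ is the identity matrix. Roots of unity are taken in an algebraic closure of $\mathbb{F}_q$. For a linear code $C\subseteq\mathbb{F}_q^N$, the Euclidean dual is $C^{\perp_E}=\{y\in\mathbb{F}_q^N:\sum_i x_iy_i=0 \text{ for all } x\in C\}$, and $C$ is Euclidean LCD if $C\cap C^{\perp_E}=\{0\}$. The code with generator matrix $G$ is the row space of $G$. *)

theory Defs
  imports
    "HOL-Algebra.Algebraic_Closure_Type"
    "Jordan_Normal_Form.VS_Connect"
begin

definition toeplitz_tridiag :: "nat \<Rightarrow> 'a::zero \<Rightarrow> 'a \<Rightarrow> 'a \<Rightarrow> 'a mat" where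
  "toeplitz_tridiag n a b c = mat n n (\<lambda>(i, j).
     if i = j then a else if i = Suc j then b else if j = Suc i then c else 0)"

definition mat_poly :: "'a::comm_semiring_1 poly \<Rightarrow> 'a mat \<Rightarrow> 'a mat" where
  "mat_poly p A = mat (dim_row A) (dim_col A) (\<lambda>(i, j).
     \<Sum>k\<le>degree p. coeff p k * (A ^\<^sub>m k) $$ (i, j))"

text \<open>The \<open>n \<times> tn\<close> matrix whose \<open>n \<times> n\<close> blocks are, from left to right,
  \<open>B 0, B 1, \<dots>, B (t - 1)\<close>.\<close>
definition block_row :: "nat \<Rightarrow> nat \<Rightarrow> (nat \<Rightarrow> 'a mat) \<Rightarrow> 'a mat" where
  "block_row n t B = mat n (t * n) (\<lambda>(i, j). B (j div n) $$ (i, j mod n))"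

text \<open>\<open>(I\<^sub>n  f\<^sub>1(A)  \<dots>  f\<^sub>t\<^sub>-\<^sub>1(A))\<close>; the value \<open>f 0\<close> is not used.\<close>
definition poly_generator_mat ::
    "nat \<Rightarrow> nat \<Rightarrow> (nat \<Rightarrow> 'a::comm_semiring_1 poly) \<Rightarrow> 'a mat \<Rightarrow> 'a mat" where
  "poly_generator_mat n t f A =
     block_row n t (\<lambda>k. if k = 0 then 1\<^sub>m n else mat_poly (f k) A)"

definition code_of_generator :: "'a::field mat \<Rightarrow> 'a vec set" where
  "code_of_generator G = vec_space.row_space (dim_col G) G"

definition euclidean_dual :: "nat \<Rightarrow> 'a::field vec set \<Rightarrow> 'a vec set" where
  "euclidean_dual N C = {y \<in> carrier_vec N. \<forall>x\<in>C. x \<bullet> y = 0}"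

definition euclidean_LCD :: "nat \<Rightarrow> 'a::field vec set \<Rightarrow> bool" where
  "euclidean_LCD N C \<longleftrightarrow> C \<inter> euclidean_dual N C = {0\<^sub>v N}"

definition is_primitive_root_of_unity :: "nat \<Rightarrow> 'a::field \<Rightarrow> bool" where
  "is_primitive_root_of_unity k z \<longleftrightarrow> 0 < k \<and> z ^ k = 1 \<and> (\<forall>j. 0 < j \<and> j < k \<longrightarrow> z ^ j \<noteq> 1)"

text \<open>Evaluation of a polynomial over a field at a point of its algebraic closure.\<close>
definition poly_ac :: "'a::field poly \<Rightarrow> 'a alg_closure \<Rightarrow> 'a alg_closure" where
  "poly_ac p x = poly (map_poly to_ac p) x"

end

theory Submission
  imports Defs "Jordan_Normal_Form.Char_Poly"
begin

text \<open>The matrix \<open>G\<close> has full row rank because of its identity block, so its row space is LCD iff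
  the Gram matrix \<open>G G\<^sup>T\<close> is nonsingular. Since \<open>T = T\<^sub>n(a, b, b)\<close> is symmetric,
  \<open>G G\<^sup>T = I + \<Sum>\<^sub>k f\<^sub>k(T)\<^sup>2\<close>, which in characteristic 2 equals \<open>(I + \<Sum>\<^sub>k f\<^sub>k(T))\<^sup>2\<close>; hence it is
  singular iff \<open>\<Sum>\<^sub>k f\<^sub>k(\<lambda>) = 1\<close> for some eigenvalue \<open>\<lambda>\<close> of \<open>T\<close> in the algebraic closure. Writing
  \<open>\<lambda> = a + b (z + 1/z)\<close>, the recurrence for an eigenvector has the solution
  \<open>(z\<^sup>j - z\<^sup>-\<^sup>j) / (z - 1/z)\<close>, or \<open>j\<close> if \<open>z = 1\<close>, which has to vanish at \<open>j = n + 1\<close>. In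
  characteristic 2 this means \<open>z\<^sup>m\<^sup>+\<^sup>1 = 1\<close> in the first case and \<open>r \<ge> 1\<close> in the second.\<close>

section \<open>Polynomials evaluated at a square matrix\<close>

lemma mat_poly_carrier [simp]: "A \<in> carrier_mat n n \<Longrightarrow> mat_poly p A \<in> carrier_mat n n"
  by (auto simp: mat_poly_def)

lemma mat_poly_dim [simp]:
  "dim_row (mat_poly p A) = dim_row A" "dim_col (mat_poly p A) = dim_col A"
  by (auto simp: mat_poly_def)

text \<open>The bound \<open>N\<close> may exceed the degree, so that polynomials of different
  degrees can be summed over one common range.\<close>

lemma mat_poly_index:
  assumes "i < dim_row A" "j < dim_col A" "degree p \<le> N"
  shows "mat_poly p A $$ (i, j) = (\<Sum>k\<le>N. coeff p k * (A ^\<^sub>m k) $$ (i, j))"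
  using assms by (auto simp: mat_poly_def intro!: sum.mono_neutral_left intro: le_degree)

lemma mat_poly_0: "A \<in> carrier_mat n n \<Longrightarrow> mat_poly 0 A = 0\<^sub>m n n"
  by (auto simp: mat_poly_def)

lemma mat_poly_add:
  fixes A :: "'a::comm_semiring_1 mat"
  assumes "A \<in> carrier_mat n n"
  shows "mat_poly (p + q) A = mat_poly p A + mat_poly q A"
proof (rule eq_matI)
  fix i j assume "i < dim_row (mat_poly p A + mat_poly q A)" "j < dim_col (mat_poly p A + mat_poly q A)"
  moreover define N where "N = max (degree p) (degree q)"
  have "degree p \<le> N" "degree q \<le> N" "degree (p + q) \<le> N"
    by (auto simp: N_def degree_add_le)
  ultimately show "mat_poly (p + q) A $$ (i, j) = (mat_poly p A + mat_poly q A) $$ (i, j)"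
    using assms by (simp add: mat_poly_index[where N = N] sum.distrib algebra_simps)
qed (use assms in auto)

lemma mat_poly_smult:
  fixes A :: "'a::comm_semiring_1 mat"
  assumes "A \<in> carrier_mat n n"
  shows "mat_poly (smult c p) A = c \<cdot>\<^sub>m mat_poly p A"
  using assms
  by (auto intro!: eq_matI simp: mat_poly_index[where N = "degree p"] degree_smult_le
      sum_distrib_left mult.assoc)

text \<open>Horner's rule, which drives the inductions on polynomials that follow.\<close>

lemma mat_poly_pCons:
  fixes A :: "'a::comm_semiring_1 mat"
  assumes A: "A \<in> carrier_mat n n"
  shows "mat_poly (pCons c p) A = c \<cdot>\<^sub>m 1\<^sub>m n + mat_poly p A * A"
proof (rule eq_matI)
  fix i j assume "i < dim_row (c \<cdot>\<^sub>m 1\<^sub>m n + mat_poly p A * A)"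
    "j < dim_col (c \<cdot>\<^sub>m 1\<^sub>m n + mat_poly p A * A)"
  hence ij: "i < n" "j < n" using A by auto
  have pow: "(A ^\<^sub>m Suc k) $$ (i, j) = (\<Sum>l<n. (A ^\<^sub>m k) $$ (i, l) * A $$ (l, j))" for k
    using ij A by (simp add: scalar_prod_def lessThan_atLeast0)
  have "mat_poly (pCons c p) A $$ (i, j)
      = (\<Sum>k\<le>Suc (degree p). coeff (pCons c p) k * (A ^\<^sub>m k) $$ (i, j))"
    using ij A by (intro mat_poly_index) (auto simp: degree_pCons_le)
  also have "\<dots> = c * 1\<^sub>m n $$ (i, j) + (\<Sum>k\<le>degree p. coeff p k * (A ^\<^sub>m Suc k) $$ (i, j))"
    using A by (simp add: sum.atMost_Suc_shift del: pow_mat.simps(2) sum.atMost_Suc)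
  also have "(\<Sum>k\<le>degree p. coeff p k * (A ^\<^sub>m Suc k) $$ (i, j))
      = (\<Sum>l<n. (\<Sum>k\<le>degree p. coeff p k * (A ^\<^sub>m k) $$ (i, l)) * A $$ (l, j))"
    unfolding pow sum_distrib_left sum_distrib_right by (subst sum.swap) (simp add: mult.assoc)
  also have "\<dots> = (mat_poly p A * A) $$ (i, j)"
    using ij A by (simp add: scalar_prod_def lessThan_atLeast0 mat_poly_index[OF _ _ order.refl])
  finally show "mat_poly (pCons c p) A $$ (i, j) = (c \<cdot>\<^sub>m 1\<^sub>m n + mat_poly p A * A) $$ (i, j)"
    using ij A by simp
qed (use A in auto)

lemma mat_poly_1: "A \<in> carrier_mat n n \<Longrightarrow> mat_poly (1 :: 'a::comm_semiring_1 poly) A = 1\<^sub>m n"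
  by (auto simp: one_pCons mat_poly_pCons mat_poly_0)

lemma mat_poly_X: "A \<in> carrier_mat n n \<Longrightarrow> mat_poly [:0, 1 :: 'a::comm_semiring_1:] A = A"
  by (auto simp: mat_poly_pCons[of _ n] mat_poly_0[of _ n])

text \<open>Induction on the right factor \<open>q\<close>: Horner's rule puts the new factor
  \<open>A\<close> at the far right, where associativity absorbs it. Commutation of polynomials in
  \<open>A\<close> is then a corollary.\<close>

lemma mat_poly_mult:
  fixes A :: "'a::comm_ring_1 mat"
  assumes A: "A \<in> carrier_mat n n"
  shows "mat_poly (p * q) A = mat_poly p A * mat_poly q A"
proof (induction q)
  case 0
  show ?case using A by (simp add: mat_poly_0[OF A] right_mult_zero_mat[of _ n n])
next
  case (pCons c q)
  let ?P = "mat_poly p A" and ?Q = "mat_poly q A"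
  note [simp] = mat_poly_carrier[OF A]
  \<comment> \<open>The product \<open>p * pCons c q\<close> is
    \<open>smult c p + pCons 0 (p * q)\<close>; the summand
    \<open>0 \<cdot>\<^sub>m 1\<^sub>m n\<close> is the constant term of the latter.\<close>
  have "mat_poly (p * pCons c q) A = c \<cdot>\<^sub>m ?P + (0 \<cdot>\<^sub>m 1\<^sub>m n + ?P * ?Q * A)"
    by (simp add: mat_poly_add[OF A] mat_poly_smult[OF A] mat_poly_pCons[OF A] pCons.IH)
  also have "0 \<cdot>\<^sub>m 1\<^sub>m n + ?P * ?Q * A = ?P * (?Q * A)"
    using A by (auto simp: assoc_mult_mat[of _ n n _ n _ n])
  also have "c \<cdot>\<^sub>m ?P + ?P * (?Q * A) = ?P * (c \<cdot>\<^sub>m 1\<^sub>m n + ?Q * A)"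
    using A by (subst mult_add_distrib_mat[of _ n n _ n]) (auto simp: mult_smult_distrib[of _ n n _ n] right_mult_one_mat[of _ n n])
  finally show ?case by (simp add: mat_poly_pCons[OF A])
qed

lemma mat_poly_transpose:
  fixes A :: "'a::comm_ring_1 mat"
  assumes A: "A \<in> carrier_mat n n"
  shows "(mat_poly p A)\<^sup>T = mat_poly p A\<^sup>T"
proof (induction p)
  case 0
  show ?case using A by (simp add: mat_poly_0[of _ n])
next
  case (pCons c p)
  note [simp] = mat_poly_carrier[OF A]
  have At: "A\<^sup>T \<in> carrier_mat n n" using A by simp
  \<comment> \<open>Transposition will reverse the product in Horner's rule, so the factors are
    swapped first. Both sides evaluate \<open>p\<close> times the indeterminate.\<close>
  have comm: "mat_poly p A * A = A * mat_poly p A"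
    using mat_poly_mult[OF A, of p "[:0, 1:]"] mat_poly_mult[OF A, of "[:0, 1:]" p]
    by (simp add: mat_poly_X[OF A] mult.commute)
  have "(mat_poly (pCons c p) A)\<^sup>T = (c \<cdot>\<^sub>m 1\<^sub>m n)\<^sup>T + (A * mat_poly p A)\<^sup>T"
    using A by (simp add: mat_poly_pCons[OF A] comm transpose_add[of _ n n])
  also have "(c \<cdot>\<^sub>m 1\<^sub>m n)\<^sup>T = c \<cdot>\<^sub>m 1\<^sub>m n" by (auto intro!: eq_matI)
  also have "(A * mat_poly p A)\<^sup>T = mat_poly p A\<^sup>T * A\<^sup>T"
    using A by (simp add: transpose_mult[of _ n n _ n] pCons.IH)
  finally show ?case by (simp add: mat_poly_pCons[OF At])
qed

section \<open>Kernels and eigenvalues of polynomials in a matrix\<close>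

lemma smult_one_mat_mult_vec:
  fixes v :: "'a::comm_semiring_1 vec"
  assumes "v \<in> carrier_vec n"
  shows "(c \<cdot>\<^sub>m 1\<^sub>m n) *\<^sub>v v = c \<cdot>\<^sub>v v"
  using assms by (auto intro!: eq_vecI)

lemma mat_poly_eigenvector:
  fixes A :: "'a::field mat"
  assumes A: "A \<in> carrier_mat n n" and v: "v \<in> carrier_vec n" and Av: "A *\<^sub>v v = c \<cdot>\<^sub>v v"
  shows "mat_poly p A *\<^sub>v v = poly p c \<cdot>\<^sub>v v"
proof (induction p)
  case 0
  show ?case using v A by (auto simp: mat_poly_0[OF A])
next
  case (pCons d p)
  note [simp] = mat_poly_carrier[OF A]
  have "mat_poly (pCons d p) A *\<^sub>v v = d \<cdot>\<^sub>v v + mat_poly p A *\<^sub>v (c \<cdot>\<^sub>v v)"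
    using A v by (simp add: mat_poly_pCons[OF A] add_mult_distrib_mat_vec[of _ n n] mult_carrier_mat[of _ n n]
        assoc_mult_mat_vec[of _ n n _ n] Av smult_one_mat_mult_vec)
  also have "mat_poly p A *\<^sub>v (c \<cdot>\<^sub>v v) = c \<cdot>\<^sub>v (poly p c \<cdot>\<^sub>v v)"
    using A v by (simp add: mult_mat_vec[of _ n n] pCons.IH)
  also have "d \<cdot>\<^sub>v v + c \<cdot>\<^sub>v (poly p c \<cdot>\<^sub>v v) = poly (pCons d p) c \<cdot>\<^sub>v v"
    by (auto simp: algebra_simps)
  finally show ?case .
qed

text \<open>Linear factors are split off one at a time: with \<open>p = [:-c, 1:] * q\<close>,
  either \<open>mat_poly q A\<close> already annihilates \<open>v\<close> and the degree drops, or
  it maps \<open>v\<close> to an eigenvector for \<open>c\<close>.\<close>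

lemma mat_poly_kernel_imp_eigenvalue:
  fixes A :: "'a::alg_closed_field mat"
  assumes A: "A \<in> carrier_mat n n" and v: "v \<in> carrier_vec n" "v \<noteq> 0\<^sub>v n"
    and p: "p \<noteq> 0" and ker: "mat_poly p A *\<^sub>v v = 0\<^sub>v n"
  shows "\<exists>c. eigenvalue A c \<and> poly p c = 0"
  using p ker
proof (induction "degree p" arbitrary: p rule: less_induct)
  case less
  note [simp] = mat_poly_carrier[OF A]
  show ?case
  proof (cases "degree p = 0")
    case True
    \<comment> \<open>A nonzero constant cannot annihilate the nonzero vector
      \<open>v\<close>.\<close>
    then obtain d where d: "p = [:d:]" using degree_eq_zeroE by blast
    hence "mat_poly p A *\<^sub>v v = d \<cdot>\<^sub>v v"
      using A v by (simp add: mat_poly_pCons[OF A] mat_poly_0[OF A] smult_one_mat_mult_vec)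
    hence "d \<cdot>\<^sub>v v = 0\<^sub>v n" using less.prems by simp
    moreover obtain i where "i < n" "v $ i \<noteq> 0" using v by (metis eq_vecI carrier_vecD index_zero_vec)
    ultimately have "d = 0" using v by (metis carrier_vecD index_smult_vec(1) index_zero_vec(1) mult_eq_0_iff)
    with d less.prems show ?thesis by simp
  next
    case False
    then obtain c where c: "poly p c = 0" using alg_closed_imp_poly_has_root by auto
    hence "[:-c, 1:] dvd p" by (simp only: poly_eq_0_iff_dvd)
    then obtain q where q: "p = [:-c, 1:] * q" by (rule dvdE)
    have q0: "q \<noteq> 0" using q less.prems by auto
    have "degree p = degree [:-c, 1:] + degree q"
      unfolding q using q0 by (intro degree_mult_eq) auto
    hence deg: "degree q < degree p" by simp
    define w where "w = mat_poly q A *\<^sub>v v"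
    have w: "w \<in> carrier_vec n" using v by (simp add: w_def mult_mat_vec_carrier[of _ n n])
    show ?thesis
    proof (cases "w = 0\<^sub>v n")
      case True
      then obtain d where "eigenvalue A d" "poly q d = 0"
        using less.hyps[OF deg q0] unfolding w_def by blast
      thus ?thesis using q by auto
    next
      case False
      have ker0: "0\<^sub>v n = mat_poly [:-c, 1:] A *\<^sub>v w"
        using less.prems(2) v unfolding q w_def mat_poly_mult[OF A]
        by (simp add: assoc_mult_mat_vec[of _ n n _ n])
      have one: "1 \<cdot>\<^sub>m 1\<^sub>m n = (1\<^sub>m n :: 'a mat)" by auto
      have "mat_poly [:-c, 1:] A *\<^sub>v w = (-c) \<cdot>\<^sub>v w + A *\<^sub>v w"
        using A w by (simp add: one mat_poly_pCons[OF A] mat_poly_0[OF A] add_mult_distrib_mat_vec[of _ n n]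
          smult_one_mat_mult_vec)
      with ker0 have eq: "(-c) \<cdot>\<^sub>v w + A *\<^sub>v w = 0\<^sub>v n" by simp
      have "A *\<^sub>v w = c \<cdot>\<^sub>v w"
      proof (rule eq_vecI)
        fix i assume "i < dim_vec (c \<cdot>\<^sub>v w)"
        moreover have "((-c) \<cdot>\<^sub>v w + A *\<^sub>v w) $ i = 0\<^sub>v n $ i" using eq by simp
        ultimately show "(A *\<^sub>v w) $ i = (c \<cdot>\<^sub>v w) $ i" using w A by simp
      qed (use w A in auto)
      hence "eigenvalue A c" using False w A by (auto simp: eigenvalue_def eigenvector_def)
      thus ?thesis using c by blast
    qed
  qed
qed

text \<open>Serves the zero polynomial in the next lemma, where any eigenvalue is a root.\<close>

lemma eigenvalue_exists:
  fixes A :: "'a::alg_closed_field mat"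
  assumes "A \<in> carrier_mat n n" "n > 0"
  shows "\<exists>c. eigenvalue A c"
proof -
  have "degree (char_poly A) > 0" using degree_monic_char_poly[OF assms(1)] assms(2) by simp
  from alg_closed_imp_poly_has_root[OF this] show ?thesis
    using eigenvalue_root_char_poly[OF assms(1)] by blast
qed

text \<open>The spectral mapping theorem at the eigenvalue 0: eigenvectors of \<open>A\<close> are
  eigenvectors of \<open>mat_poly p A\<close>, and kernel vectors of \<open>mat_poly p A\<close>
  lead back to eigenvalues of \<open>A\<close>.\<close>

lemma det_mat_poly_eq_0_iff:
  fixes A :: "'a::alg_closed_field mat"
  assumes A: "A \<in> carrier_mat n n" and n: "n > 0"
  shows "det (mat_poly p A) = 0 \<longleftrightarrow> (\<exists>c. eigenvalue A c \<and> poly p c = 0)"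
proof
  assume "det (mat_poly p A) = 0"
  then obtain v where v: "v \<in> carrier_vec n" "v \<noteq> 0\<^sub>v n" "mat_poly p A *\<^sub>v v = 0\<^sub>v n"
    using det_0_iff_vec_prod_zero_field[OF mat_poly_carrier[OF A]] by blast
  show "\<exists>c. eigenvalue A c \<and> poly p c = 0"
  proof (cases "p = 0")
    case True
    thus ?thesis using eigenvalue_exists[OF A n] by simp
  next
    case False
    thus ?thesis using mat_poly_kernel_imp_eigenvalue[OF A] v by blast
  qed
next
  assume "\<exists>c. eigenvalue A c \<and> poly p c = 0"
  then obtain c v where "poly p c = 0" and v: "v \<in> carrier_vec n" "v \<noteq> 0\<^sub>v n" "A *\<^sub>v v = c \<cdot>\<^sub>v v"
    using A by (auto simp: eigenvalue_def eigenvector_def)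
  hence "mat_poly p A *\<^sub>v v = 0\<^sub>v n" using mat_poly_eigenvector[OF A v(1) v(3), of p] by auto
  thus "det (mat_poly p A) = 0"
    using det_0_iff_vec_prod_zero_field[OF mat_poly_carrier[OF A]] v by blast
qed

section \<open>Passage to the algebraic closure\<close>

lemma map_mat_mat_poly_to_ac:
  fixes A :: "'a::field mat"
  assumes A: "A \<in> carrier_mat n n"
  shows "map_mat to_ac (mat_poly p A) = mat_poly (map_poly to_ac p) (map_mat to_ac A)"
proof (rule eq_matI)
  interpret to_ac: inj_comm_ring_hom "to_ac :: 'a \<Rightarrow> 'a alg_closure"
    by unfold_locales auto
  fix i j assume "i < dim_row (mat_poly (map_poly to_ac p) (map_mat to_ac A))"
    "j < dim_col (mat_poly (map_poly to_ac p) (map_mat to_ac A))"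
  \<comment> \<open>Since \<open>to_ac\<close> is injective, the degree and with it the range of
    summation are unchanged.\<close>
  thus "map_mat to_ac (mat_poly p A) $$ (i, j) = mat_poly (map_poly to_ac p) (map_mat to_ac A) $$ (i, j)"
    using A by (simp add: mat_poly_index[where N = "degree p"] to_ac_sum degree_map_poly coeff_map_poly
        flip: to_ac.mat_hom_pow[OF A])
qed auto

lemma map_mat_toeplitz_tridiag:
  "g 0 = 0 \<Longrightarrow> map_mat g (toeplitz_tridiag n a b c) = toeplitz_tridiag n (g a) (g b) (g c)"
  by (auto simp: toeplitz_tridiag_def)

section \<open>Gram matrices and the LCD property\<close>

lemma dim_block_row [simp]:
  "dim_row (block_row n t B) = n" "dim_col (block_row n t B) = t * n"
  by (simp_all add: block_row_def)

lemma block_row_carrier [simp]: "block_row n t B \<in> carrier_mat n (t * n)"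
  by (simp add: block_row_def)

text \<open>The column index is regrouped as \<open>l + k * n\<close> with \<open>l < n\<close>, so
  that \<open>div n\<close> gives the block and \<open>mod n\<close> the column inside it.\<close>

lemma block_row_mult_transpose_index:
  fixes B :: "nat \<Rightarrow> 'a::comm_semiring_0 mat"
  assumes B: "\<And>k. k < t \<Longrightarrow> B k \<in> carrier_mat n n" and ij: "i < n" "j < n"
  shows "(block_row n t B * (block_row n t B)\<^sup>T) $$ (i, j) = (\<Sum>k<t. (B k * (B k)\<^sup>T) $$ (i, j))"
proof -
  let ?g = "\<lambda>l. B (l div n) $$ (i, l mod n) * B (l div n) $$ (j, l mod n)"
  have "(block_row n t B * (block_row n t B)\<^sup>T) $$ (i, j) = (\<Sum>l<t * n. ?g l)"
    using ij by (simp add: scalar_prod_def lessThan_atLeast0 block_row_def)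
  also have "\<dots> = (\<Sum>k<t. sum ?g {k * n..<k * n + n})"
    by (rule sum.nat_group [symmetric])
  also have "\<dots> = (\<Sum>k<t. \<Sum>l<n. ?g (l + k * n))"
  proof (rule sum.cong)
    fix k
    show "sum ?g {k * n..<k * n + n} = (\<Sum>l<n. ?g (l + k * n))"
      using sum.shift_bounds_nat_ivl[of ?g 0 "k * n" n]
      by (simp only: add_0 add.commute[of n] atLeast0LessThan)
  qed simp
  also have "\<dots> = (\<Sum>k<t. (B k * (B k)\<^sup>T) $$ (i, j))"
  proof (rule sum.cong)
    fix k assume "k \<in> {..<t}"
    hence "B k \<in> carrier_mat n n" using B by simp
    thus "(\<Sum>l<n. ?g (l + k * n)) = (B k * (B k)\<^sup>T) $$ (i, j)"
      using ij by (simp add: scalar_prod_def lessThan_atLeast0)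
  qed simp
  finally show ?thesis .
qed

text \<open>Massey's criterion. The assumption \<open>inj\<close> expresses full row rank; under it
  \<open>x \<mapsto> G\<^sup>T *\<^sub>v x\<close> maps the kernel of the Gram matrix bijectively
  onto the intersection of the code with its dual.\<close>

lemma euclidean_LCD_code_of_generator_iff:
  fixes G :: "'a::field mat"
  assumes G: "G \<in> carrier_mat n N"
    and inj: "\<And>x. x \<in> carrier_vec n \<Longrightarrow> G\<^sup>T *\<^sub>v x = 0\<^sub>v N \<Longrightarrow> x = 0\<^sub>v n"
  shows "euclidean_LCD N (code_of_generator G) \<longleftrightarrow> det (G * G\<^sup>T) \<noteq> 0"
proof -
  interpret vec_space "TYPE('a)" N .
  have Gt: "G\<^sup>T \<in> carrier_mat N n" using G by simp
  have C: "code_of_generator G = {G\<^sup>T *\<^sub>v x | x. x \<in> carrier_vec n}"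
  proof -
    have "code_of_generator G = row_space G" using G by (simp add: code_of_generator_def)
    also have "\<dots> = {w \<in> carrier_vec N. \<exists>x\<in>carrier_vec n. G\<^sup>T *\<^sub>v x = w}"
      unfolding row_space_eq[OF G] using G by simp
    also have "\<dots> = {G\<^sup>T *\<^sub>v x | x. x \<in> carrier_vec n}"
      using mult_mat_vec_carrier[OF Gt] by blast
    finally show ?thesis .
  qed
  have GGt: "G * G\<^sup>T \<in> carrier_mat n n" using G by simp
  have dual: "G\<^sup>T *\<^sub>v x \<in> euclidean_dual N (code_of_generator G) \<longleftrightarrow> (G * G\<^sup>T) *\<^sub>v x = 0\<^sub>v n"
    if x: "x \<in> carrier_vec n" for x
  proof -
    \<comment> \<open>Moving \<open>G\<^sup>T\<close> across the scalar product turns orthogonality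
      to all codewords into a condition on the Gram matrix.\<close>
    have scalar: "(G\<^sup>T *\<^sub>v y) \<bullet> (G\<^sup>T *\<^sub>v x) = y \<bullet> ((G * G\<^sup>T) *\<^sub>v x)" if "y \<in> carrier_vec n" for y
      using transpose_vec_mult_scalar[OF G _ that, of "G\<^sup>T *\<^sub>v x"] x G Gt
      by (simp add: assoc_mult_mat_vec[OF G Gt x] mult_mat_vec_carrier[OF Gt x])
    have w: "(G * G\<^sup>T) *\<^sub>v x \<in> carrier_vec n" by (rule mult_mat_vec_carrier[OF GGt x])
    have "G\<^sup>T *\<^sub>v x \<in> euclidean_dual N (code_of_generator G)
        \<longleftrightarrow> (\<forall>y\<in>carrier_vec n. y \<bullet> ((G * G\<^sup>T) *\<^sub>v x) = 0)"
      unfolding C euclidean_dual_def using scalar mult_mat_vec_carrier[OF Gt x] by auto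
    also have "\<dots> \<longleftrightarrow> (G * G\<^sup>T) *\<^sub>v x = 0\<^sub>v n"
    proof
      assume *: "\<forall>y\<in>carrier_vec n. y \<bullet> ((G * G\<^sup>T) *\<^sub>v x) = 0"
      show "(G * G\<^sup>T) *\<^sub>v x = 0\<^sub>v n"
      proof (rule eq_vecI)
        fix i assume "i < dim_vec (0\<^sub>v n :: 'a vec)"
        \<comment> \<open>Testing against a unit vector reads off one entry.\<close>
        thus "((G * G\<^sup>T) *\<^sub>v x) $ i = 0\<^sub>v n $ i"
          using *[rule_format, of "unit_vec n i"] scalar_prod_left_unit[OF w, of i] by simp
      qed (use G in simp)
    qed auto
    finally show ?thesis .
  qed
  have "euclidean_LCD N (code_of_generator G)
      \<longleftrightarrow> (\<forall>x\<in>carrier_vec n. (G * G\<^sup>T) *\<^sub>v x = 0\<^sub>v n \<longrightarrow> x = 0\<^sub>v n)"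
  proof
    assume lcd: "euclidean_LCD N (code_of_generator G)"
    show "\<forall>x\<in>carrier_vec n. (G * G\<^sup>T) *\<^sub>v x = 0\<^sub>v n \<longrightarrow> x = 0\<^sub>v n"
    proof (intro ballI impI)
      fix x :: "'a vec" assume x: "x \<in> carrier_vec n" and "(G * G\<^sup>T) *\<^sub>v x = 0\<^sub>v n"
      with dual have "G\<^sup>T *\<^sub>v x \<in> euclidean_dual N (code_of_generator G)" by simp
      moreover have "G\<^sup>T *\<^sub>v x \<in> code_of_generator G" using C x by blast
      ultimately have "G\<^sup>T *\<^sub>v x = 0\<^sub>v N" using lcd unfolding euclidean_LCD_def by blast
      thus "x = 0\<^sub>v n" by (rule inj[OF x])
    qed
  next
    assume ker: "\<forall>x\<in>carrier_vec n. (G * G\<^sup>T) *\<^sub>v x = 0\<^sub>v n \<longrightarrow> x = 0\<^sub>v n"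
    have mult_0: "M *\<^sub>v 0\<^sub>v n = 0\<^sub>v k" if "M \<in> carrier_mat k n" for M :: "'a mat" and k
      using that by (auto intro!: eq_vecI)
    have zero: "G\<^sup>T *\<^sub>v 0\<^sub>v n = 0\<^sub>v N" "(G * G\<^sup>T) *\<^sub>v 0\<^sub>v n = 0\<^sub>v n"
      using mult_0 Gt GGt by blast+
    show "euclidean_LCD N (code_of_generator G)"
      unfolding euclidean_LCD_def
    proof (intro equalityI subsetI)
      fix y assume "y \<in> code_of_generator G \<inter> euclidean_dual N (code_of_generator G)"
      moreover from this obtain x where x: "x \<in> carrier_vec n" "y = G\<^sup>T *\<^sub>v x" using C by auto
      ultimately have "(G * G\<^sup>T) *\<^sub>v x = 0\<^sub>v n" using dual[OF x(1)] by simp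
      hence "x = 0\<^sub>v n" using ker x(1) by simp
      thus "y \<in> {0\<^sub>v N}" using x(2) zero(1) by simp
    next
      fix y :: "'a vec" assume "y \<in> {0\<^sub>v N}"
      hence y: "y = G\<^sup>T *\<^sub>v 0\<^sub>v n" using zero(1) by simp
      have "y \<in> code_of_generator G" unfolding C y by (intro CollectI exI[of _ "0\<^sub>v n"]) simp
      moreover have "y \<in> euclidean_dual N (code_of_generator G)"
        unfolding y by (subst dual) (simp_all only: zero_carrier_vec zero(2))
      ultimately show "y \<in> code_of_generator G \<inter> euclidean_dual N (code_of_generator G)" ..
    qed
  qed
  also have "\<dots> \<longleftrightarrow> det (G * G\<^sup>T) \<noteq> 0"
    using det_0_iff_vec_prod_zero_field[OF GGt] by blast
  finally show ?thesis .
qed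

section \<open>Eigenvalues of the tridiagonal Toeplitz matrix\<close>

text \<open>In terms of Chebyshev polynomials of the second kind, \<open>tridiag_seq \<mu> (Suc j) = U\<^sub>j(\<mu> / 2)\<close>.\<close>
fun tridiag_seq :: "'a::comm_ring_1 \<Rightarrow> nat \<Rightarrow> 'a" where
  "tridiag_seq \<mu> 0 = 0"
| "tridiag_seq \<mu> (Suc 0) = 1"
| "tridiag_seq \<mu> (Suc (Suc j)) = \<mu> * tridiag_seq \<mu> (Suc j) - tridiag_seq \<mu> j"

text \<open>Multiplying by \<open>z - inverse z\<close> instead of dividing keeps the identity free
  of a case distinction; it carries no information when this factor is 0.\<close>

lemma tridiag_seq_closed_form:
  fixes z :: "'a::field"
  assumes "z \<noteq> 0"
  shows "tridiag_seq (z + inverse z) j * (z - inverse z) = z ^ j - inverse z ^ j"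
proof (induction j rule: induct_nat_012)
  case (ge2 j)
  have [simp]: "z * (inverse z * y) = y" "inverse z * (z * y) = y" for y
    using assms by (simp_all flip: mult.assoc)
  have "tridiag_seq (z + inverse z) (Suc (Suc j)) * (z - inverse z)
      = (z + inverse z) * (tridiag_seq (z + inverse z) (Suc j) * (z - inverse z))
        - tridiag_seq (z + inverse z) j * (z - inverse z)"
    by (simp add: algebra_simps)
  also have "\<dots> = (z + inverse z) * (z ^ Suc j - inverse z ^ Suc j) - (z ^ j - inverse z ^ j)"
    by (simp only: ge2)
  also have "\<dots> = z ^ Suc (Suc j) - inverse z ^ Suc (Suc j)"
    by (simp add: algebra_simps)
  finally show ?case .
qed auto

text \<open>The degenerate case \<open>z = 1\<close> of the closed form.\<close>

lemma tridiag_seq_2: "tridiag_seq 2 j = of_nat j"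
proof (induction j rule: induct_nat_012)
  case (ge2 j)
  thus ?case by (simp add: algebra_simps)
qed auto

lemma toeplitz_tridiag_carrier [simp]: "toeplitz_tridiag n a b c \<in> carrier_mat n n"
  by (simp add: toeplitz_tridiag_def)

text \<open>Entry \<open>j\<close> of the vector is \<open>w (Suc j)\<close>, which leaves the
  positions 0 and \<open>n + 1\<close> free for boundary values. The conditionals drop the
  neighbours that the first and last rows do not have.\<close>

lemma toeplitz_tridiag_mult_vec_index:
  fixes a :: "'a::comm_ring_1"
  assumes i: "i < n"
  shows "(toeplitz_tridiag n a b b *\<^sub>v vec n (\<lambda>j. w (Suc j))) $ i
    = b * (if i = 0 then 0 else w i) + a * w (Suc i) + b * (if Suc i = n then 0 else w (Suc (Suc i)))"
proof -
  have "(toeplitz_tridiag n a b b *\<^sub>v vec n (\<lambda>j. w (Suc j))) $ i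
      = (\<Sum>j<n. (if i = j then a else if i = Suc j then b else if j = Suc i then b else 0) * w (Suc j))"
    using i by (simp add: toeplitz_tridiag_def scalar_prod_def lessThan_atLeast0)
  \<comment> \<open>For \<open>i = 0\<close> truncated subtraction makes \<open>i - 1\<close> equal
    to 0, a valid index, so the inner conditional has to cancel that term.\<close>
  also have "\<dots> = (\<Sum>j<n. (if j = i then a * w (Suc i) else 0)
      + (if j = i - 1 then (if i = 0 then 0 else b * w i) else 0) + (if j = Suc i then b * w (Suc (Suc i)) else 0))"
    by (rule sum.cong) auto
  also have "\<dots> = a * w (Suc i) + (if i = 0 then 0 else b * w i) + (if Suc i < n then b * w (Suc (Suc i)) else 0)"
    using i by (simp add: sum.distrib)
  finally show ?thesis using i by (auto simp: algebra_simps)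
qed

text \<open>An eigenvector, extended by zero to the positions \<open>0\<close> and \<open>n + 1\<close>, satisfies the
  recurrence of \<open>tridiag_seq\<close>, and so is a multiple of it.\<close>
lemma eigenvalue_toeplitz_tridiag_iff:
  fixes a b \<mu> :: "'a::field"
  assumes b: "b \<noteq> 0" and n: "n > 0"
  shows "eigenvalue (toeplitz_tridiag n a b b) (a + b * \<mu>) \<longleftrightarrow> tridiag_seq \<mu> (Suc n) = 0"
    (is "eigenvalue ?T _ \<longleftrightarrow> _")
proof
  assume "eigenvalue ?T (a + b * \<mu>)"
  then obtain v where v: "v \<in> carrier_vec n" "v \<noteq> 0\<^sub>v n" "?T *\<^sub>v v = (a + b * \<mu>) \<cdot>\<^sub>v v"
    unfolding eigenvalue_def eigenvector_def by (auto simp: toeplitz_tridiag_def)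
  define w where "w j = (if j = 0 \<or> n < j then 0 else v $ (j - 1))" for j
  have v_eq: "v = vec n (\<lambda>j. w (Suc j))"
    using v(1) by (auto simp: w_def)
  \<comment> \<open>Row \<open>i\<close> of the eigenvector equation: the terms in \<open>a\<close>
    cancel, and the rest is divided by \<open>b\<close>.\<close>
  have rec: "w (Suc (Suc i)) = \<mu> * w (Suc i) - w i" if i: "i < n" for i
  proof -
    have "(?T *\<^sub>v v) $ i = b * w i + a * w (Suc i) + b * w (Suc (Suc i))"
      unfolding v_eq toeplitz_tridiag_mult_vec_index[OF i] using i by (auto simp: w_def)
    moreover have "((a + b * \<mu>) \<cdot>\<^sub>v v) $ i = (a + b * \<mu>) * w (Suc i)"
      using i v(1) by (simp add: w_def)
    ultimately have "b * w (Suc (Suc i)) = b * (\<mu> * w (Suc i) - w i)"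
      using v(3) by (simp add: algebra_simps)
    thus ?thesis using b by simp
  qed
  have w: "j \<le> Suc n \<Longrightarrow> w j = w 1 * tridiag_seq \<mu> j" for j
  proof (induction j rule: induct_nat_012)
    case (ge2 j)
    thus ?case using rec[of j] by (simp add: algebra_simps)
  qed (auto simp: w_def)
  have "w 1 \<noteq> 0"
  proof
    assume "w 1 = 0"
    hence "w (Suc j) = 0" if "j < n" for j using w[of "Suc j"] that by simp
    hence "v = 0\<^sub>v n" by (subst v_eq) (auto intro!: eq_vecI)
    with v(2) show False ..
  qed
  with w[of "Suc n"] show "tridiag_seq \<mu> (Suc n) = 0" by (simp add: w_def)
next
  assume end0: "tridiag_seq \<mu> (Suc n) = 0"
  \<comment> \<open>The sequence itself, at positions 1 to \<open>n\<close>, is the eigenvector. Its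
    zero at \<open>Suc n\<close> stands in for the missing neighbour in the last row, and its first
    entry 1 makes it nonzero.\<close>
  define v where "v = vec n (\<lambda>j. tridiag_seq \<mu> (Suc j))"
  have "?T *\<^sub>v v = (a + b * \<mu>) \<cdot>\<^sub>v v"
  proof (rule eq_vecI)
    fix i assume "i < dim_vec ((a + b * \<mu>) \<cdot>\<^sub>v v)"
    hence i: "i < n" by (simp add: v_def)
    have "(?T *\<^sub>v v) $ i = b * tridiag_seq \<mu> i + a * tridiag_seq \<mu> (Suc i) + b * tridiag_seq \<mu> (Suc (Suc i))"
      unfolding v_def toeplitz_tridiag_mult_vec_index[OF i] using end0 by auto
    thus "(?T *\<^sub>v v) $ i = ((a + b * \<mu>) \<cdot>\<^sub>v v) $ i"
      using i by (simp add: v_def algebra_simps)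
  qed (simp add: v_def toeplitz_tridiag_def)
  moreover have "v $ 0 = 1" using n by (simp add: v_def)
  hence "v \<noteq> 0\<^sub>v n" using n by auto
  ultimately show "eigenvalue ?T (a + b * \<mu>)"
    unfolding eigenvalue_def eigenvector_def by (intro exI[of _ v]) (auto simp: v_def toeplitz_tridiag_def)
qed

text \<open>Here \<open>z\<close> is a root of the quadratic with coefficients 1,
  \<open>-\<mu>\<close>, 1; its constant term 1 excludes the root 0.\<close>

lemma alg_closed_sum_inverse:
  fixes \<mu> :: "'a::alg_closed_field"
  obtains z where "z \<noteq> 0" "\<mu> = z + inverse z"
proof -
  have "\<exists>z. poly [:1, -\<mu>, 1:] z = 0" by (rule alg_closed_imp_poly_has_root) simp
  then obtain z where z: "1 + z * (z - \<mu>) = 0" by (auto simp: algebra_simps)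
  hence "z \<noteq> 0" by auto
  moreover from this z have "\<mu> = z + inverse z" by (simp add: field_simps eq_neg_iff_add_eq_0)
  ultimately show ?thesis using that by blast
qed

section \<open>Roots of unity and eigenvalues in characteristic 2\<close>

text \<open>By Frobenius, \<open>x ^ (2 ^ k) + 1\<close> is a power of \<open>x + 1\<close>. This
  removes the factor \<open>2 ^ r\<close> from the exponent \<open>n + 1\<close> later.\<close>

lemma char_2_power_eq_1_iff:
  fixes x :: "'a::field"
  assumes "CHAR('a) = 2"
  shows "x ^ (2 ^ k) = 1 \<longleftrightarrow> x = 1"
proof -
  have "(x + 1) ^ (2 ^ k) = x ^ (2 ^ k) + 1 ^ (2 ^ k)"
    by (rule freshmans_dream') (auto simp: assms)
  moreover have "y + 1 = 0 \<longleftrightarrow> y = 1" for y :: 'a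
    using uminus_CHAR_2[OF assms, of 1] by (metis add_eq_0_iff2)
  ultimately show ?thesis by (metis power_one power_not_zero power_0_left power_eq_0_iff)
qed

text \<open>The first \<open>N\<close> powers of \<theta> are distinct roots of a polynomial with at
  most \<open>N\<close> roots, so they exhaust them.\<close>

lemma primitive_root_powers:
  fixes \<theta> z :: "'a::field"
  assumes prim: "is_primitive_root_of_unity N \<theta>" and z: "z ^ N = 1"
  shows "\<exists>i<N. z = \<theta> ^ i"
proof -
  have N: "N > 0" and th: "\<theta> ^ N = 1" and min: "\<And>j. 0 < j \<Longrightarrow> j < N \<Longrightarrow> \<theta> ^ j \<noteq> 1"
    using prim by (auto simp: is_primitive_root_of_unity_def)
  have th0: "\<theta> \<noteq> 0" using th N by (auto simp: power_0_left)
  define p :: "'a poly" where "p = monom 1 N - 1"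
  have p_root: "poly p x = 0 \<longleftrightarrow> x ^ N = 1" for x by (simp add: p_def poly_monom)
  have "coeff p N = 1" using N by (simp add: p_def)
  hence p0: "p \<noteq> 0" by auto
  have "degree p \<le> N" unfolding p_def by (intro degree_diff_le) (auto simp: degree_monom_le)
  hence card: "card {x :: 'a. x ^ N = 1} \<le> N"
    using card_poly_roots_bound[OF p0] by (simp add: p_root)
  have fin: "finite {x :: 'a. x ^ N = 1}"
    using poly_roots_finite[OF p0] by (simp add: p_root)
  have "inj_on (\<lambda>i. \<theta> ^ i) {..<N}"
  proof (rule linorder_inj_onI)
    fix i j assume "i < j" "i \<in> {..<N}" "j \<in> {..<N}"
    hence "\<theta> ^ (j - i) \<noteq> 1" by (intro min) auto
    thus "\<theta> ^ i \<noteq> \<theta> ^ j" using \<open>i < j\<close> th0 by (auto simp: power_diff)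
  qed auto
  hence "card ((\<lambda>i. \<theta> ^ i) ` {..<N}) = N" by (simp add: card_image)
  moreover have "(\<lambda>i. \<theta> ^ i) ` {..<N} \<subseteq> {x. x ^ N = 1}"
  proof clarify
    fix i
    have "(\<theta> ^ i) ^ N = (\<theta> ^ N) ^ i" by (simp add: mult.commute flip: power_mult)
    thus "(\<theta> ^ i) ^ N = 1" using th by simp
  qed
  ultimately have "(\<lambda>i. \<theta> ^ i) ` {..<N} = {x. x ^ N = 1}"
    using card fin by (metis card_subset_eq card_mono le_antisym)
  thus ?thesis using z by auto
qed

text \<open>Every \<open>c\<close> has the form \<open>a + b * (z + inverse z)\<close>. The
  parameter \<open>z = 1\<close> gives \<open>c = a\<close>, because 2 is 0, and is governed by the
  parity of \<open>n + 1\<close>; any other \<open>z\<close> has to be an \<open>(m + 1)\<close>-th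
  root of unity.\<close>

lemma eigenvalue_toeplitz_tridiag_char_2_iff:
  fixes a b c :: "'a::alg_closed_field"
  assumes char: "CHAR('a) = 2" and b: "b \<noteq> 0" and n: "n > 0" and nm: "n + 1 = 2 ^ r * (m + 1)"
    and m: "even m"
  shows "eigenvalue (toeplitz_tridiag n a b b) c
    \<longleftrightarrow> r \<ge> 1 \<and> c = a \<or> (\<exists>z. z ^ (m + 1) = 1 \<and> z \<noteq> 1 \<and> c = a + b * (z + inverse z))"
proof -
  have two: "(2 :: 'a) = 0" using of_nat_CHAR[where 'a = 'a] char by simp
  have inv: "z = inverse z \<longleftrightarrow> z = 1" if "z \<noteq> 0" for z :: 'a
  proof -
    have "z = inverse z \<longleftrightarrow> z ^ (2 ^ 1) = 1" using that by (auto simp: field_simps power2_eq_square)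
    thus ?thesis using char_2_power_eq_1_iff[OF char, of z 1] by simp
  qed
  have self_inv: "z + inverse z = 0" if "z = 1" for z :: 'a using that two by simp
  \<comment> \<open>As 2 is 0, the sequence for parameter 0 takes the value of \<open>n + 1\<close>
    in the field at the end point. Evenness of \<open>m\<close> makes \<open>m + 1\<close> odd, so
    \<open>n + 1\<close> is even exactly when \<open>r \<ge> 1\<close>.\<close>
  have zero: "tridiag_seq 0 (Suc n) = (0 :: 'a) \<longleftrightarrow> r \<ge> 1"
  proof -
    have "tridiag_seq 0 (Suc n) = (0 :: 'a) \<longleftrightarrow> 2 dvd n + 1"
      using tridiag_seq_2[where 'a = 'a, of "Suc n"] of_nat_eq_0_iff_char_dvd[where 'a = 'a, of "Suc n"]
      by (simp add: two char)
    also have "\<dots> \<longleftrightarrow> r \<ge> 1" unfolding nm using m by (cases r) auto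
    finally show ?thesis .
  qed
  have nonzero: "tridiag_seq (z + inverse z) (Suc n) = 0 \<longleftrightarrow> z ^ (m + 1) = 1"
    if z: "z \<noteq> 0" "z \<noteq> 1" for z :: 'a
  proof -
    have "z - inverse z \<noteq> 0" using inv z by auto
    \<comment> \<open>After cancelling \<open>z - inverse z\<close>, the power
      \<open>z ^ Suc n\<close> must be its own inverse, which in characteristic 2 forces it to be
      1.\<close>
    hence "tridiag_seq (z + inverse z) (Suc n) = 0 \<longleftrightarrow> z ^ Suc n = inverse (z ^ Suc n)"
      using tridiag_seq_closed_form[OF z(1), of "Suc n"] by (auto simp: power_inverse simp del: power_Suc)
    also have "\<dots> \<longleftrightarrow> z ^ (n + 1) = 1" using inv[of "z ^ (n + 1)"] z(1) by (simp only: Suc_eq_plus1) simp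
    also have "\<dots> \<longleftrightarrow> (z ^ (m + 1)) ^ (2 ^ r) = 1" unfolding nm by (metis mult.commute power_mult)
    finally show ?thesis using char_2_power_eq_1_iff[OF char] by simp
  qed
  obtain z where z: "z \<noteq> 0" "(c - a) / b = z + inverse z" by (rule alg_closed_sum_inverse)
  have c: "c = a + b * (z + inverse z)" using z(2) b by (simp add: field_simps)
  show ?thesis
  proof
    assume "eigenvalue (toeplitz_tridiag n a b b) c"
    hence e: "tridiag_seq (z + inverse z) (Suc n) = 0"
      unfolding c eigenvalue_toeplitz_tridiag_iff[OF b n] .
    show "r \<ge> 1 \<and> c = a \<or> (\<exists>z. z ^ (m + 1) = 1 \<and> z \<noteq> 1 \<and> c = a + b * (z + inverse z))"
    proof (cases "z = 1")
      case True
      thus ?thesis using e zero self_inv[OF True] c by simp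
    next
      case False
      thus ?thesis using e nonzero[OF z(1) False] c by blast
    qed
  next
    assume "r \<ge> 1 \<and> c = a \<or> (\<exists>z. z ^ (m + 1) = 1 \<and> z \<noteq> 1 \<and> c = a + b * (z + inverse z))"
    thus "eigenvalue (toeplitz_tridiag n a b b) c"
    proof (elim disjE exE conjE)
      assume "r \<ge> 1" "c = a"
      thus ?thesis using eigenvalue_toeplitz_tridiag_iff[OF b n, of a 0] zero by simp
    next
      fix y assume y: "y ^ (m + 1) = 1" "y \<noteq> 1" "c = a + b * (y + inverse y)"
      hence "y \<noteq> 0" by auto
      thus ?thesis using eigenvalue_toeplitz_tridiag_iff[OF b n, of a "y + inverse y"] nonzero[of y] y by simp
    qed
  qed
qed

text \<open>Replacing \<open>i\<close> by \<open>m + 1 - i\<close> inverts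
  \<open>\<theta> ^ i\<close> and so preserves the sum. As \<open>m\<close> is even, each such pair
  of exponents has one member in the lower half.\<close>

lemma primitive_root_nontrivial_powers:
  fixes \<theta> :: "'a::field"
  assumes prim: "is_primitive_root_of_unity (m + 1) \<theta>" and m: "even m"
  shows "{z + inverse z | z. z ^ (m + 1) = 1 \<and> z \<noteq> 1}
    = {\<theta> ^ i + inverse (\<theta> ^ i) | i. 1 \<le> i \<and> i \<le> m div 2}" (is "?A = ?B")
proof
  have th: "\<theta> ^ (m + 1) = 1" and min: "\<And>j. 0 < j \<Longrightarrow> j < m + 1 \<Longrightarrow> \<theta> ^ j \<noteq> 1"
    using prim by (auto simp: is_primitive_root_of_unity_def)
  show "?A \<subseteq> ?B"
  proof
    fix x assume "x \<in> ?A"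
    then obtain z where z: "z ^ (m + 1) = 1" "z \<noteq> 1" "x = z + inverse z" by blast
    obtain i where i: "i < m + 1" "z = \<theta> ^ i" using primitive_root_powers[OF prim z(1)] by blast
    have i0: "i \<noteq> 0" using i z(2) by (intro notI) simp
    show "x \<in> ?B"
    proof (cases "i \<le> m div 2")
      case True
      thus ?thesis using i i0 z(3) by (intro CollectI exI[of _ i]) auto
    next
      case False
      define j where "j = m + 1 - i"
      have "\<theta> ^ i * \<theta> ^ j = 1" using i th by (simp add: j_def flip: power_add)
      hence "inverse (\<theta> ^ i) = \<theta> ^ j" "inverse (\<theta> ^ j) = \<theta> ^ i"
        by (metis inverse_unique, metis inverse_unique mult.commute)
      hence "x = \<theta> ^ j + inverse (\<theta> ^ j)" using z(3) i(2) by (simp add: add.commute)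
      moreover have "1 \<le> j" "j \<le> m div 2" using False i m by (auto simp: j_def elim!: evenE)
      ultimately show ?thesis by blast
    qed
  qed
  show "?B \<subseteq> ?A"
  proof
    fix x assume "x \<in> ?B"
    then obtain i where i: "1 \<le> i" "i \<le> m div 2" "x = \<theta> ^ i + inverse (\<theta> ^ i)" by blast
    have "(\<theta> ^ i) ^ (m + 1) = (\<theta> ^ (m + 1)) ^ i" by (metis mult.commute power_mult)
    hence "(\<theta> ^ i) ^ (m + 1) = 1" using th by simp
    moreover have "\<theta> ^ i \<noteq> 1" using i by (intro min) auto
    ultimately show "x \<in> ?A" using i(3) by blast
  qed
qed

section \<open>The LCD criterion for polynomial generator matrices\<close>

lemma mat_poly_sum_index:
  fixes A :: "'a::comm_semiring_1 mat"
  assumes A: "A \<in> carrier_mat n n" and ij: "i < n" "j < n"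
  shows "mat_poly (\<Sum>k\<in>S. p k) A $$ (i, j) = (\<Sum>k\<in>S. mat_poly (p k) A $$ (i, j))"
proof (induction S rule: infinite_finite_induct)
  case (insert x F)
  thus ?case using A ij mat_poly_carrier[OF A]
    by (simp add: mat_poly_add[OF A])
qed (use A ij in \<open>simp_all add: mat_poly_0[OF A]\<close>)

text \<open>Symmetry of \<open>A\<close> passes to every \<open>mat_poly (f k) A\<close>, so each
  block contributes its square to the Gram matrix; the identity block contributes the constant
  polynomial 1.\<close>

lemma euclidean_LCD_poly_generator_iff:
  fixes A :: "'a::field mat"
  assumes A: "A \<in> carrier_mat n n" and sym: "A\<^sup>T = A" and t: "t > 0"
  shows "euclidean_LCD (t * n) (code_of_generator (poly_generator_mat n t f A))
    \<longleftrightarrow> det (mat_poly (1 + (\<Sum>k = 1..t - 1. (f k)\<^sup>2)) A) \<noteq> 0"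
proof -
  define B where "B k = (if k = 0 then 1\<^sub>m n else mat_poly (f k) A)" for k
  define G where "G = block_row n t B"
  have B: "B k \<in> carrier_mat n n" for k by (simp add: B_def mat_poly_carrier[OF A])
  have G: "G \<in> carrier_mat n (t * n)" by (simp add: G_def)
  have inj: "x = 0\<^sub>v n" if x: "x \<in> carrier_vec n" and eq: "G\<^sup>T *\<^sub>v x = 0\<^sub>v (t * n)" for x
  proof (rule eq_vecI)
    fix i assume "i < dim_vec (0\<^sub>v n :: 'a vec)"
    hence i: "i < n" by simp
    with t have i': "i < t * n" by (metis less_le_trans mult_le_mono1 nat_mult_1 Suc_leI One_nat_def)
    \<comment> \<open>The identity block makes the first \<open>n\<close> entries of
      \<open>G\<^sup>T *\<^sub>v x\<close> equal to those of \<open>x\<close>, which gives full row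
      rank.\<close>
    have "col G i = unit_vec n i"
      using i i' by (auto simp: G_def block_row_def B_def unit_vec_def)
    hence "x $ i = (G\<^sup>T *\<^sub>v x) $ i" using i i' x by (simp add: G_def)
    thus "x $ i = 0\<^sub>v n $ i" using i i' eq by simp
  qed (use x in simp)
  have square: "B k * (B k)\<^sup>T = (if k = 0 then 1\<^sub>m n else mat_poly ((f k)\<^sup>2) A)" for k
    by (simp add: B_def mat_poly_transpose[OF A] sym power2_eq_square mat_poly_mult[OF A])
  have gram: "G * G\<^sup>T = mat_poly (1 + (\<Sum>k = 1..t - 1. (f k)\<^sup>2)) A"
  proof (rule eq_matI)
    fix i j
    assume "i < dim_row (mat_poly (1 + (\<Sum>k = 1..t - 1. (f k)\<^sup>2)) A)"
      and "j < dim_col (mat_poly (1 + (\<Sum>k = 1..t - 1. (f k)\<^sup>2)) A)"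
    hence ij: "i < n" "j < n" using A by auto
    have split: "{..<t} = insert 0 {1..t - 1}" using t by auto
    have "(G * G\<^sup>T) $$ (i, j) = (\<Sum>k<t. (B k * (B k)\<^sup>T) $$ (i, j))"
      unfolding G_def by (rule block_row_mult_transpose_index) (use B ij in auto)
    also have "\<dots> = 1\<^sub>m n $$ (i, j) + (\<Sum>k = 1..t - 1. mat_poly ((f k)\<^sup>2) A $$ (i, j))"
      unfolding square split by (subst sum.insert) (auto intro!: sum.cong)
    also have "\<dots> = mat_poly (1 + (\<Sum>k = 1..t - 1. (f k)\<^sup>2)) A $$ (i, j)"
      using ij A
      by (simp add: mat_poly_add[OF A] mat_poly_1[OF A] mat_poly_sum_index[OF A])
    finally show "(G * G\<^sup>T) $$ (i, j) = mat_poly (1 + (\<Sum>k = 1..t - 1. (f k)\<^sup>2)) A $$ (i, j)" .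
  qed (use A G in auto)
  have generator: "poly_generator_mat n t f A = G"
    unfolding poly_generator_mat_def G_def B_def ..
  have "euclidean_LCD (t * n) (code_of_generator G) \<longleftrightarrow> det (G * G\<^sup>T) \<noteq> 0"
    by (rule euclidean_LCD_code_of_generator_iff[OF G]) (rule inj)
  thus ?thesis unfolding generator gram .
qed

lemma euclidean_LCD_poly_generator_char_2_iff:
  fixes A :: "'a::field mat"
  assumes char: "CHAR('a) = 2"
    and A: "A \<in> carrier_mat n n" and sym: "A\<^sup>T = A" and n: "n > 0" and t: "t > 0"
  shows "euclidean_LCD (t * n) (code_of_generator (poly_generator_mat n t f A))
    \<longleftrightarrow> (\<forall>c. eigenvalue (map_mat to_ac A) c \<longrightarrow> (\<Sum>k = 1..t - 1. poly_ac (f k) c) \<noteq> 1)"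
proof -
  interpret to_ac: inj_comm_ring_hom "to_ac :: 'a \<Rightarrow> 'a alg_closure"
    by unfold_locales auto
  interpret to_ac_poly: map_poly_inj_comm_ring_hom "to_ac :: 'a \<Rightarrow> 'a alg_closure" ..
  let ?h = "1 + (\<Sum>k = 1..t - 1. (f k)\<^sup>2)"
  have char': "CHAR('a alg_closure) = 2" using char by simp
  have root: "poly (map_poly to_ac ?h) c = 0 \<longleftrightarrow> (\<Sum>k = 1..t - 1. poly_ac (f k) c) = 1" for c
  proof -
    have "poly (map_poly to_ac ?h) c = 1 + (\<Sum>k = 1..t - 1. (poly_ac (f k) c)\<^sup>2)"
      by (simp add: poly_ac_def hom_distribs poly_sum)
    \<comment> \<open>Additivity of squaring in characteristic 2 turns the sum of squares into a
      single square.\<close>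
    also have "\<dots> = (1 + (\<Sum>k = 1..t - 1. poly_ac (f k) c))\<^sup>2"
      by (simp add: char freshmans_dream freshmans_dream_sum)
    finally show ?thesis
      by (simp only: power_eq_0_iff add_eq_0_iff uminus_CHAR_2[OF char']) simp
  qed
  \<comment> \<open>The injective homomorphism \<open>to_ac\<close> preserves and reflects vanishing
    of the determinant, so eigenvalues may be taken in the closure.\<close>
  have "det (mat_poly ?h A) = 0 \<longleftrightarrow> det (map_mat to_ac (mat_poly ?h A)) = 0"
    by simp
  also have "\<dots> \<longleftrightarrow> (\<exists>c. eigenvalue (map_mat to_ac A) c \<and> poly (map_poly to_ac ?h) c = 0)"
    unfolding map_mat_mat_poly_to_ac[OF A]
    by (rule det_mat_poly_eq_0_iff) (use A n in auto)
  finally have singular: "det (mat_poly ?h A) = 0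
    \<longleftrightarrow> (\<exists>c. eigenvalue (map_mat to_ac A) c \<and> poly (map_poly to_ac ?h) c = 0)" .
  show ?thesis
    unfolding euclidean_LCD_poly_generator_iff[OF A sym t] singular root by simp
qed

lemma toeplitz_tridiag_symmetric: "(toeplitz_tridiag n a b b)\<^sup>T = toeplitz_tridiag n a b b"
  by (auto simp: toeplitz_tridiag_def)

text \<open>Brings the condition at the eigenvalue \<open>a\<close> back to the base field.\<close>

lemma poly_ac_to_ac: "poly_ac p (to_ac x) = to_ac (poly p x)"
  by (induction p) (simp_all add: poly_ac_def map_poly_pCons)

section \<open>The three cases of the factorization of \<open>n + 1\<close>\<close>

theorem theorem4p1:
  fixes a b :: "'a::{field,finite}"
    and n t r m :: nat
    and f :: "nat \<Rightarrow> 'a poly"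
    and C :: "'a vec set"
  assumes "CHAR('a) = 2"
    and "b \<noteq> 0"
    and "n \<ge> 2"
    and "t \<ge> 2"
    and "C = code_of_generator (poly_generator_mat n t f (toeplitz_tridiag n a b b))"
    and "n + 1 = 2 ^ r * (m + 1)"
    and "\<forall>r' m'. n + 1 = 2 ^ r' * (m' + 1) \<longrightarrow> r' \<le> r"
  shows "(r = 0 \<longrightarrow>
            (\<forall>\<theta> :: 'a alg_closure. is_primitive_root_of_unity (n + 1) \<theta> \<longrightarrow>
              (euclidean_LCD (t * n) C \<longleftrightarrow>
                1 \<notin> {\<Sum>k = 1..t - 1. poly_ac (f k) (to_ac a - to_ac b * (\<theta> ^ i + inverse (\<theta> ^ i))) | i.
                       1 \<le> i \<and> i \<le> n div 2})))
       \<and> (r \<ge> 1 \<and> m \<ge> 1 \<longrightarrow>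
            (\<forall>\<theta> :: 'a alg_closure. is_primitive_root_of_unity (m + 1) \<theta> \<longrightarrow>
              (euclidean_LCD (t * n) C \<longleftrightarrow>
                1 \<notin> {to_ac (\<Sum>k = 1..t - 1. poly (f k) a)} \<union>
                     {\<Sum>k = 1..t - 1. poly_ac (f k) (to_ac a + to_ac b * (\<theta> ^ i + inverse (\<theta> ^ i))) | i.
                       1 \<le> i \<and> i \<le> m div 2})))
       \<and> (r \<ge> 1 \<and> m = 0 \<longrightarrow>
            (euclidean_LCD (t * n) C \<longleftrightarrow> 1 \<notin> {\<Sum>k = 1..t - 1. poly (f k) a}))"
proof -
  define S where "S c = (\<Sum>k = 1..t - 1. poly_ac (f k) c)" for c
  define T where "T = toeplitz_tridiag n a b b"
  have char: "CHAR('a alg_closure) = 2" using assms(1) by simp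
  have b: "to_ac b \<noteq> 0" and n: "n > 0" and t: "t > 0" using assms by auto
  \<comment> \<open>If \<open>m\<close> were odd, another factor 2 could be taken out of
    \<open>m + 1\<close>, against the maximality of \<open>r\<close>.\<close>
  have m: "even m"
  proof (rule ccontr)
    assume "odd m"
    then obtain l where "m = 2 * l + 1" by (elim oddE)
    hence "n + 1 = 2 ^ Suc r * (l + 1)" using assms(6) by simp
    hence "Suc r \<le> r" using assms(7) by blast
    thus False by simp
  qed
  have T: "T \<in> carrier_mat n n" and T_sym: "T\<^sup>T = T"
    by (simp_all add: T_def toeplitz_tridiag_symmetric)
  have map_T: "map_mat to_ac T = toeplitz_tridiag n (to_ac a) (to_ac b) (to_ac b)"
    by (simp add: T_def map_mat_toeplitz_tridiag)
  define E where "E = {z + inverse z | z :: 'a alg_closure. z ^ (m + 1) = 1 \<and> z \<noteq> 1}"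
  have "euclidean_LCD (t * n) C \<longleftrightarrow> (\<forall>c. eigenvalue (map_mat to_ac T) c \<longrightarrow> S c \<noteq> 1)"
    unfolding assms(5) S_def T_def [symmetric]
    by (rule euclidean_LCD_poly_generator_char_2_iff[OF assms(1) T T_sym n t])
  \<comment> \<open>The eigenvalues split into \<open>a\<close>, guaranteed by
    \<open>r \<ge> 1\<close>, and those given by nontrivial roots of unity through
    \<open>E\<close>.\<close>
  also have "\<dots> \<longleftrightarrow> (r \<ge> 1 \<longrightarrow> S (to_ac a) \<noteq> 1) \<and> (\<forall>x\<in>E. S (to_ac a + to_ac b * x) \<noteq> 1)"
    unfolding map_T eigenvalue_toeplitz_tridiag_char_2_iff[OF char b n assms(6) m] E_def by blast
  finally have lcd: "euclidean_LCD (t * n) C \<longleftrightarrow>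
    (r \<ge> 1 \<longrightarrow> S (to_ac a) \<noteq> 1) \<and> (\<forall>x\<in>E. S (to_ac a + to_ac b * x) \<noteq> 1)" .
  have E: "E = {\<theta> ^ i + inverse (\<theta> ^ i) | i. 1 \<le> i \<and> i \<le> m div 2}"
    if "is_primitive_root_of_unity (m + 1) \<theta>" for \<theta>
    unfolding E_def by (rule primitive_root_nontrivial_powers[OF that m])
  have S_a: "S (to_ac a) = to_ac (\<Sum>k = 1..t - 1. poly (f k) a)"
    by (simp add: S_def poly_ac_to_ac to_ac_sum)
  \<comment> \<open>Reconciles the minus sign of the first case with the plus sign in the
    parametrization of the eigenvalues.\<close>
  have minus: "x - y = x + y" for x y :: "'a alg_closure"
    using minus_CHAR_2[OF char] .
  show ?thesis
  proof (intro conjI impI allI)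
    fix \<theta> :: "'a alg_closure"
    assume r: "r = 0" and th: "is_primitive_root_of_unity (n + 1) \<theta>"
    hence "n = m" using assms(6) by simp
    with th have "is_primitive_root_of_unity (m + 1) \<theta>" by simp
    from E[OF this] \<open>n = m\<close> r show "euclidean_LCD (t * n) C \<longleftrightarrow>
        1 \<notin> {\<Sum>k = 1..t - 1. poly_ac (f k) (to_ac a - to_ac b * (\<theta> ^ i + inverse (\<theta> ^ i))) | i.
          1 \<le> i \<and> i \<le> n div 2}"
      unfolding lcd minus S_def [symmetric] by auto
  next
    fix \<theta> :: "'a alg_closure"
    assume r: "r \<ge> 1 \<and> m \<ge> 1" and th: "is_primitive_root_of_unity (m + 1) \<theta>"
    thus "euclidean_LCD (t * n) C \<longleftrightarrow>
        1 \<notin> {to_ac (\<Sum>k = 1..t - 1. poly (f k) a)} \<union>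
          {\<Sum>k = 1..t - 1. poly_ac (f k) (to_ac a + to_ac b * (\<theta> ^ i + inverse (\<theta> ^ i))) | i.
            1 \<le> i \<and> i \<le> m div 2}"
      unfolding lcd S_a [symmetric] S_def [symmetric] E[OF th] by auto
  next
    assume r: "r \<ge> 1 \<and> m = 0"
    \<comment> \<open>For \<open>m = 0\<close> the only root of unity in question is 1, which
      \<open>E\<close> excludes.\<close>
    hence "E = {}" unfolding E_def by simp
    thus "euclidean_LCD (t * n) C \<longleftrightarrow> 1 \<notin> {\<Sum>k = 1..t - 1. poly (f k) a}"
      unfolding lcd S_a using r eq_commute[of 1 "\<Sum>k = 1..t - 1. poly (f k) a"] by simp
  qed
qed

end
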